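(* Let $G$ be a group, $x\in G$, $n:=o(x)>2$, and let $\alpha\in\{1+x+x^{-1},\,1+x+x^2\}\subset\mathbb{F}_2[G]$. Suppose that $\alpha\beta=0$ for some non-zero $\beta\in\mathbb{F}_2[G]$, where $1\in supp(\beta)$ and $|supp(\beta)|$ is minimum among all non-zero elements of $\mathbb{F}_2[G]$ with the property $\alpha\beta=0$. Then $n$ must be a multiple of $3$ and $|supp(\beta)|=2n/3$.
   Context: $\mathbb{F}_2$ is the field with two elements. The support of $\alpha=\sum_{g\in G}\alpha_g g\in \mathbb{F}_2[G]$ is $supp(\alpha)=\{g\in G : \alpha_g\neq 0\}$. $o(x)$ denotes the order of $x$, a priori allowed to be infinite; that $n$ is a multiple of $3$ means in particular that $n$ is finite. *)

theory Defs
  imports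
    "HOL-Algebra.Ring"
    "HOL-Algebra.Multiplicative_Group"
    "HOL-Library.Poly_Mapping"
    "HOL-Library.Z2"
    "HOL-Library.Extended_Nat"
begin

text \<open>
  The group ring \<open>R[G]\<close>: a formal sum \<open>\<Sum>g. a\<^sub>g g\<close> is the finitely supported function
  \<open>g \<mapsto> a\<^sub>g\<close>, so that its support is \<open>Poly_Mapping.keys\<close>; \<open>\<bbbF>\<^sub>2[G]\<close> is the case where
  the coefficients have type \<^typ>\<open>bit\<close>. The multiplication of \<open>poly_mapping\<close> itself is not
  the one needed here, since it refers to an additive monoid structure on the type of indices.
\<close>

definition group_ring_mult ::
    "('a, 'm) monoid_scheme \<Rightarrow> ('a \<Rightarrow>\<^sub>0 'b) \<Rightarrow> ('a \<Rightarrow>\<^sub>0 'b) \<Rightarrow> ('a \<Rightarrow>\<^sub>0 'b::semiring_1)" where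
  "group_ring_mult G a b =
    (\<Sum>g\<in>Poly_Mapping.keys a. \<Sum>h\<in>Poly_Mapping.keys b.
       Poly_Mapping.single (g \<otimes>\<^bsub>G\<^esub> h) (Poly_Mapping.lookup a g * Poly_Mapping.lookup b h))"

definition group_ring :: "('a, 'm) monoid_scheme \<Rightarrow> ('a \<Rightarrow>\<^sub>0 'b::semiring_1) ring" where
  "group_ring G =
    \<lparr>carrier = {a. Poly_Mapping.keys a \<subseteq> carrier G},
     monoid.mult = group_ring_mult G,
     one = Poly_Mapping.single \<one>\<^bsub>G\<^esub> 1,
     zero = 0,
     add = (+)\<rparr>"

abbreviation group_ring_F2 :: "('a, 'm) monoid_scheme \<Rightarrow> ('a \<Rightarrow>\<^sub>0 bit) ring" where
  "group_ring_F2 G \<equiv> group_ring G"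

definition group_elem :: "'a \<Rightarrow> ('a \<Rightarrow>\<^sub>0 'b::semiring_1)" where
  "group_elem g = Poly_Mapping.single g 1"

text \<open>\<^const>\<open>group.ord\<close> is \<open>0\<close> on elements of infinite order.\<close>

definition elem_order :: "('a, 'm) monoid_scheme \<Rightarrow> 'a \<Rightarrow> enat" where
  "elem_order G x = (if group.ord G x = 0 then \<infinity> else enat (group.ord G x))"

lemma group_ring_simps [simp]:
  "a \<in> carrier (group_ring G) \<longleftrightarrow> Poly_Mapping.keys a \<subseteq> carrier G"
  "a \<otimes>\<^bsub>group_ring G\<^esub> b = group_ring_mult G a b"
  "\<one>\<^bsub>group_ring G\<^esub> = group_elem \<one>\<^bsub>G\<^esub>"
  "\<zero>\<^bsub>group_ring G\<^esub> = 0"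
  "a \<oplus>\<^bsub>group_ring G\<^esub> b = a + b"
  by (simp_all add: group_ring_def group_elem_def)

lemma group_ring_mult_superset:
  assumes "finite A" "finite B" "Poly_Mapping.keys a \<subseteq> A" "Poly_Mapping.keys b \<subseteq> B"
  shows "group_ring_mult G a b =
    (\<Sum>g\<in>A. \<Sum>h\<in>B.
       Poly_Mapping.single (g \<otimes>\<^bsub>G\<^esub> h) (Poly_Mapping.lookup a g * Poly_Mapping.lookup b h))"
proof -
  have "(\<Sum>h\<in>Poly_Mapping.keys b. Poly_Mapping.single (g \<otimes>\<^bsub>G\<^esub> h)
            (Poly_Mapping.lookup a g * Poly_Mapping.lookup b h)) =
        (\<Sum>h\<in>B. Poly_Mapping.single (g \<otimes>\<^bsub>G\<^esub> h)
            (Poly_Mapping.lookup a g * Poly_Mapping.lookup b h))" for g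
    by (rule sum.mono_neutral_left) (use assms in \<open>auto simp: in_keys_iff\<close>)
  then show ?thesis
    unfolding group_ring_mult_def
    by simp (rule sum.mono_neutral_left; use assms in \<open>auto simp: in_keys_iff\<close>)
qed

lemma group_ring_mult_zero [simp]:
  "group_ring_mult G 0 b = 0" "group_ring_mult G a 0 = 0"
  by (simp_all add: group_ring_mult_def)

lemma group_ring_mult_add_left:
  "group_ring_mult G (a + b) c = group_ring_mult G a c + group_ring_mult G b c"
proof -
  let ?A = "Poly_Mapping.keys a \<union> Poly_Mapping.keys b" and ?C = "Poly_Mapping.keys c"
  have "Poly_Mapping.keys (a + b) \<subseteq> ?A" by (rule Poly_Mapping.keys_add)
  then show ?thesis
    by (simp add: group_ring_mult_superset[of ?A ?C] lookup_add distrib_right single_add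
        sum.distrib)
qed

lemma group_ring_mult_add_right:
  "group_ring_mult G c (a + b) = group_ring_mult G c a + group_ring_mult G c b"
proof -
  let ?A = "Poly_Mapping.keys a \<union> Poly_Mapping.keys b" and ?C = "Poly_Mapping.keys c"
  have "Poly_Mapping.keys (a + b) \<subseteq> ?A" by (rule Poly_Mapping.keys_add)
  then show ?thesis
    by (simp add: group_ring_mult_superset[of ?C ?A] lookup_add distrib_left single_add
        sum.distrib)
qed

lemma group_ring_mult_sum_left:
  "group_ring_mult G (\<Sum>i\<in>I. f i) c = (\<Sum>i\<in>I. group_ring_mult G (f i) c)"
  by (induction I rule: infinite_finite_induct) (simp_all add: group_ring_mult_add_left)

lemma group_ring_mult_sum_right:
  "group_ring_mult G c (\<Sum>i\<in>I. f i) = (\<Sum>i\<in>I. group_ring_mult G c (f i))"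
  by (induction I rule: infinite_finite_induct) (simp_all add: group_ring_mult_add_right)

lemma group_ring_mult_single_left:
  "group_ring_mult G (Poly_Mapping.single g r) b =
    (\<Sum>h\<in>Poly_Mapping.keys b.
       Poly_Mapping.single (g \<otimes>\<^bsub>G\<^esub> h) (r * Poly_Mapping.lookup b h))"
  by (subst group_ring_mult_superset[of "{g}" "Poly_Mapping.keys b"]) auto

lemma group_ring_mult_single_right:
  "group_ring_mult G a (Poly_Mapping.single h s) =
    (\<Sum>g\<in>Poly_Mapping.keys a.
       Poly_Mapping.single (g \<otimes>\<^bsub>G\<^esub> h) (Poly_Mapping.lookup a g * s))"
  by (subst group_ring_mult_superset[of "Poly_Mapping.keys a" "{h}"]) auto

lemma group_ring_mult_single:
  "group_ring_mult G (Poly_Mapping.single g r) (Poly_Mapping.single h s) =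
    Poly_Mapping.single (g \<otimes>\<^bsub>G\<^esub> h) (r * s)"
  by (subst group_ring_mult_superset[of "{g}" "{h}"]) auto

lemma keys_group_ring_mult:
  assumes "monoid G" "Poly_Mapping.keys a \<subseteq> carrier G" "Poly_Mapping.keys b \<subseteq> carrier G"
  shows "Poly_Mapping.keys (group_ring_mult G a b) \<subseteq> carrier G"
  unfolding group_ring_mult_def
  using assms
  by (intro order_trans[OF keys_sum] UN_least) (auto intro!: monoid.m_closed split: if_splits)

lemma group_ring_mult_assoc:
  assumes "monoid G"
    "Poly_Mapping.keys a \<subseteq> carrier G" "Poly_Mapping.keys b \<subseteq> carrier G"
    "Poly_Mapping.keys c \<subseteq> carrier G"
  shows "group_ring_mult G (group_ring_mult G a b) c = group_ring_mult G a (group_ring_mult G b c)"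
proof -
  let ?t = "\<lambda>g h k. Poly_Mapping.single (g \<otimes>\<^bsub>G\<^esub> h \<otimes>\<^bsub>G\<^esub> k)
    (Poly_Mapping.lookup a g * Poly_Mapping.lookup b h * Poly_Mapping.lookup c k)"
  let ?t' = "\<lambda>g h k. Poly_Mapping.single (g \<otimes>\<^bsub>G\<^esub> (h \<otimes>\<^bsub>G\<^esub> k))
    (Poly_Mapping.lookup a g * (Poly_Mapping.lookup b h * Poly_Mapping.lookup c k))"
  let ?S = "\<lambda>t. \<Sum>g\<in>Poly_Mapping.keys a. \<Sum>h\<in>Poly_Mapping.keys b. \<Sum>k\<in>Poly_Mapping.keys c. t g h k"
  have "group_ring_mult G (group_ring_mult G a b) c = ?S ?t"
    by (simp add: group_ring_mult_def[of G a b] group_ring_mult_sum_left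
        group_ring_mult_single_left)
  also have "\<dots> = ?S ?t'"
    using assms by (intro sum.cong refl) (auto simp: monoid.m_assoc subset_iff mult.assoc)
  also have "\<dots> = (\<Sum>h\<in>Poly_Mapping.keys b. \<Sum>k\<in>Poly_Mapping.keys c.
      \<Sum>g\<in>Poly_Mapping.keys a. ?t' g h k)"
    by (subst sum.swap) (rule sum.cong[OF refl], rule sum.swap)
  also have "\<dots> = group_ring_mult G a (group_ring_mult G b c)"
    by (simp add: group_ring_mult_def[of G b c] group_ring_mult_sum_right
        group_ring_mult_single_right)
  finally show ?thesis .
qed

lemma sum_single_lookup:
  "(\<Sum>g\<in>Poly_Mapping.keys a. Poly_Mapping.single g (Poly_Mapping.lookup a g)) = a"
  by (rule poly_mapping_eqI) (auto simp: lookup_sum lookup_single when_def in_keys_iff)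

theorem ring_group_ring:
  assumes "monoid G"
  shows "ring (group_ring G :: ('a \<Rightarrow>\<^sub>0 'b::ring_1) ring)"
proof (rule ringI)
  let ?R = "group_ring G :: ('a \<Rightarrow>\<^sub>0 'b) ring"
  interpret G: monoid G by fact
  show "abelian_group ?R"
  proof (rule abelian_groupI)
    fix x assume "x \<in> carrier ?R"
    then show "\<exists>y\<in>carrier ?R. y \<oplus>\<^bsub>?R\<^esub> x = \<zero>\<^bsub>?R\<^esub>"
      by (intro bexI[of _ "- x"]) auto
  qed (use Poly_Mapping.keys_add in \<open>fastforce simp: add.assoc add.commute\<close>)+
  show "monoid ?R"
  proof (rule monoidI)
    fix x assume "x \<in> carrier ?R"
    then have x: "Poly_Mapping.keys x \<subseteq> carrier G" by simp
    have "group_ring_mult G (group_elem \<one>\<^bsub>G\<^esub>) x =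
        (\<Sum>g\<in>Poly_Mapping.keys x. Poly_Mapping.single g (Poly_Mapping.lookup x g))"
      using x by (auto simp: group_elem_def group_ring_mult_single_left intro!: sum.cong)
    then show "\<one>\<^bsub>?R\<^esub> \<otimes>\<^bsub>?R\<^esub> x = x" by (simp add: sum_single_lookup)
    have "group_ring_mult G x (group_elem \<one>\<^bsub>G\<^esub>) =
        (\<Sum>g\<in>Poly_Mapping.keys x. Poly_Mapping.single g (Poly_Mapping.lookup x g))"
      using x by (auto simp: group_elem_def group_ring_mult_single_right intro!: sum.cong)
    then show "x \<otimes>\<^bsub>?R\<^esub> \<one>\<^bsub>?R\<^esub> = x" by (simp add: sum_single_lookup)
  qed (use assms in \<open>auto simp: group_ring_mult_assoc group_elem_def
          dest: subsetD[OF keys_group_ring_mult[OF assms], rotated -1]\<close>)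
qed (simp_all add: group_ring_mult_add_left group_ring_mult_add_right)

end

theory Submission
  imports Defs
begin

text \<open>
  Read along the powers of \<open>x\<close>, the coefficients of \<open>\<beta>\<close> form a sequence
  \<open>u k = \<beta>(x\<^sup>k)\<close> with \<open>u 0 = 1\<close>. For both choices of \<open>\<alpha>\<close>, comparing coefficients shows
  that \<open>\<alpha>\<beta> = 0\<close> says exactly that \<open>\<beta>(g) + \<beta>(xg) + \<beta>(x\<^sup>2g) = 0\<close> for all \<open>g\<close>
  (\<open>annihilated_iff_three_term\<close>): the two candidates for \<open>\<alpha>\<close> differ by the unit \<open>x\<close>, so they
  have the same annihilator. Hence \<open>u\<close> satisfies \<open>u k + u (k + 1) + u (k + 2) = 0\<close> over
  \<open>\<bbbF>\<^sub>2\<close>, which forces period \<open>3\<close>, with exactly two of any three consecutive terms equal to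
  \<open>1\<close>.

  If \<open>x\<close> had infinite order, the distinct elements \<open>x\<^sup>3\<^sup>k\<close> would all lie in the finite support
  of \<open>\<beta>\<close>. If \<open>x\<close> has finite order \<open>m\<close>, then \<open>u\<close> also has period \<open>m\<close>; were \<open>m\<close> not divisible
  by \<open>3\<close>, then \<open>0\<close>, \<open>m\<close>, \<open>2m\<close> would represent the three residues modulo \<open>3\<close> and \<open>u\<close> would be
  constantly \<open>1\<close>, whereas \<open>1 + 1 + 1 \<noteq> 0\<close>. So \<open>3\<close> divides \<open>m\<close>, and \<open>\<beta>\<close> has exactly \<open>2m/3\<close>
  support elements among the powers of \<open>x\<close>.

  Finally, the three-term condition only relates elements of the same right coset of \<open>\<langle>x\<rangle>\<close>, so
  the restriction of \<open>\<beta>\<close> to \<open>\<langle>x\<rangle>\<close> is again annihilated by \<open>\<alpha>\<close>. It is non-zero because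
  \<open>1 \<in> supp \<beta>\<close>, so minimality forces \<open>supp \<beta>\<close> into \<open>\<langle>x\<rangle>\<close>, and the count above is
  \<open>|supp \<beta>|\<close>.
\<close>

section \<open>Three-term recurrences over the field with two elements\<close>

lemma bit_sum3_eq_0_iff:
  fixes a b c :: bit
  shows "a + b + c = 0 \<longleftrightarrow> c = a + b"
  by (cases a; cases b; cases c) simp_all

locale three_term_recurrence =
  fixes u :: "nat \<Rightarrow> bit"
  assumes recurrence: "u k + u (Suc k) + u (Suc (Suc k)) = 0"
begin

lemma period_3: "u (k + 3) = u k"
proof -
  have "u (Suc (Suc (Suc k))) = u (Suc k) + (u k + u (Suc k))"
    using recurrence[of k] recurrence[of "Suc k"] by (simp only: bit_sum3_eq_0_iff)
  also have "\<dots> = u k"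
    by (cases "u k"; cases "u (Suc k)") simp_all
  finally show ?thesis
    by (simp add: numeral_3_eq_3)
qed

lemma period_multiple_3: "u (k + 3 * j) = u k"
proof (induction j)
  case (Suc j)
  then show ?case
    using period_3[of "k + 3 * j"] by (simp add: algebra_simps)
qed simp

lemma mod_3: "u (k mod 3) = u k"
  using period_multiple_3[of "k mod 3" "k div 3"] by simp

text \<open>
  Each block \<open>3q, 3q + 1, 3q + 2\<close> contributes two ones: its sum vanishes, so the number of
  ones in it is even, and its first term is \<open>u 0 = 1\<close> by periodicity.
\<close>
lemma card_ones:
  assumes "u 0 = 1"
  shows "card {k. k < 3 * q \<and> u k = 1} = 2 * q"
proof (induction q)
  case (Suc q)
  have block: "u (3 * q) = 1" "u (3 * q + 1) = u 1" "u (3 * q + 2) = u 2"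
    using assms period_multiple_3[of 0 q] period_multiple_3[of 1 q] period_multiple_3[of 2 q]
    by (simp_all add: add.commute)
  have u2: "u 2 = 1 + u 1"
    using recurrence[of 0] assms
    by (simp only: bit_sum3_eq_0_iff numeral_2_eq_2 One_nat_def)
  \<comment> \<open>The index of the second one in the block depends on the free initial value \<open>u 1\<close>.\<close>
  define j where "j = (if u 1 = 1 then 3 * q + 1 else 3 * q + 2)"
  have "k < 3 * Suc q \<longleftrightarrow> k < 3 * q \<or> k \<in> {3 * q, 3 * q + 1, 3 * q + 2}" for k
    by auto
  then have "{k. k < 3 * Suc q \<and> u k = 1} =
      {k. k < 3 * q \<and> u k = 1} \<union> {k \<in> {3 * q, 3 * q + 1, 3 * q + 2}. u k = 1}"
    by blast
  also have "{k \<in> {3 * q, 3 * q + 1, 3 * q + 2}. u k = 1} = {3 * q, j}"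
  proof (cases "u 1 = 1")
    case True
    then have "u (3 * q + 1) = 1" "u (3 * q + 2) = 0" "j = 3 * q + 1"
      by (simp_all only: block u2 j_def one_add_one bit_2_eq_0 if_True simp_thms)
    with block(1) show ?thesis
      by auto
  next
    case False
    then have "u (3 * q + 1) = 0" "u (3 * q + 2) = 1" "j = 3 * q + 2"
      by (simp_all only: block u2 j_def bit_not_one_iff add_0_right zero_neq_one if_False simp_thms)
    with block(1) show ?thesis
      by auto
  qed
  finally have "{k. k < 3 * Suc q \<and> u k = 1} = insert (3 * q) (insert j {k. k < 3 * q \<and> u k = 1})"
    by blast
  moreover have "j \<notin> {k. k < 3 * q \<and> u k = 1}" "3 * q \<notin> insert j {k. k < 3 * q \<and> u k = 1}"
    by (auto simp: j_def)
  ultimately show ?case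
    using Suc by simp
qed simp

lemma dvd_period:
  assumes "u 0 = 1" and period: "\<And>k. u (k + m) = u k"
  shows "3 dvd m"
proof (rule ccontr)
  assume "\<not> 3 dvd m"
  have ones: "u m = 1" "u (2 * m) = 1"
    using assms(1) period[of 0] period[of m] by (simp_all add: mult_2)
  \<comment> \<open>\<open>m\<close> and \<open>2m\<close> represent the residues \<open>1\<close> and \<open>2\<close> in one order or the other.\<close>
  have "m mod 3 = 1 \<and> (2 * m) mod 3 = 2 \<or> m mod 3 = 2 \<and> (2 * m) mod 3 = 1"
    using \<open>\<not> 3 dvd m\<close> by presburger
  then have "u 1 = 1" "u 2 = 1"
    using ones mod_3[of m] mod_3[of "2 * m"] by auto
  then show False
    using recurrence[of 0] assms(1) by (simp add: numeral_2_eq_2)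
qed

end

section \<open>The annihilator in the group ring\<close>

context group
begin

lemma lookup_group_elem_mult:
  fixes b :: "'a \<Rightarrow>\<^sub>0 'c::semiring_1"
  assumes "h \<in> carrier G" "g \<in> carrier G" "Poly_Mapping.keys b \<subseteq> carrier G"
  shows "Poly_Mapping.lookup (group_ring_mult G (group_elem h) b) g =
    Poly_Mapping.lookup b (inv h \<otimes> g)"
proof -
  have "h \<otimes> k = g \<longleftrightarrow> k = inv h \<otimes> g" if "k \<in> carrier G" for k
    using inv_solve_left[of k h g] assms that by auto
  then have "(\<Sum>k\<in>Poly_Mapping.keys b. Poly_Mapping.lookup b k when h \<otimes> k = g) =
      (\<Sum>k\<in>Poly_Mapping.keys b. Poly_Mapping.lookup b k when k = inv h \<otimes> g)"
    using assms by (intro sum.cong) (auto simp: subset_iff)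
  also have "\<dots> = Poly_Mapping.lookup b (inv h \<otimes> g)"
    by (auto simp: when_def in_keys_iff)
  finally show ?thesis
    by (simp add: group_elem_def group_ring_mult_single_left lookup_sum lookup_single)
qed

text \<open>
  The coefficient of \<open>\<alpha>b\<close> at \<open>h\<close> sums three coefficients of \<open>b\<close> at consecutive points of the
  \<open>x\<close>-orbit of \<open>h\<close>, starting from \<open>x\<^sup>-\<^sup>1h\<close> or \<open>x\<^sup>-\<^sup>2h\<close> depending on \<open>\<alpha>\<close>. As \<open>h\<close> runs over
  the whole group, so does the starting point, and the difference disappears.
\<close>
lemma annihilated_iff_three_term:
  fixes b :: "'a \<Rightarrow>\<^sub>0 bit"
  assumes x: "x \<in> carrier G"
    and \<alpha>: "\<alpha> \<in> {group_elem \<one> + group_elem x + group_elem (inv x),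
                 group_elem \<one> + group_elem x + group_elem (x [^] (2::nat))}"
    and b: "Poly_Mapping.keys b \<subseteq> carrier G"
  shows "group_ring_mult G \<alpha> b = 0 \<longleftrightarrow>
    (\<forall>g\<in>carrier G. Poly_Mapping.lookup b g + Poly_Mapping.lookup b (x \<otimes> g)
       + Poly_Mapping.lookup b (x \<otimes> (x \<otimes> g)) = 0)"
    (is "_ \<longleftrightarrow> (\<forall>g\<in>carrier G. ?T g = 0)")
proof -
  obtain y where y: "y \<in> carrier G"
    and coeff: "\<And>g. g \<in> carrier G \<Longrightarrow>
      Poly_Mapping.lookup (group_ring_mult G \<alpha> b) (y \<otimes> g) = ?T g"
  proof (cases "\<alpha> = group_elem \<one> + group_elem x + group_elem (inv x)")
    case True
    have [simp]: "inv x \<otimes> (x \<otimes> g) = g" if "g \<in> carrier G" for g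
      using x that by (simp flip: m_assoc)
    have "Poly_Mapping.lookup (group_ring_mult G \<alpha> b) (x \<otimes> g) =
        Poly_Mapping.lookup b (x \<otimes> g) + Poly_Mapping.lookup b g
          + Poly_Mapping.lookup b (x \<otimes> (x \<otimes> g))" if "g \<in> carrier G" for g
      using x b that
      by (simp add: True group_ring_mult_add_left lookup_add lookup_group_elem_mult)
    then have "Poly_Mapping.lookup (group_ring_mult G \<alpha> b) (x \<otimes> g) = ?T g"
      if "g \<in> carrier G" for g
      using that by (simp only: add_ac)
    with x show ?thesis by (rule that)
  next
    case False
    with \<alpha> have \<alpha>': "\<alpha> = group_elem \<one> + group_elem x + group_elem (x [^] (2::nat))"
      by simp
    have [simp]: "inv x \<otimes> (x \<otimes> (x \<otimes> g)) = x \<otimes> g"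
      "inv (x \<otimes> x) \<otimes> (x \<otimes> (x \<otimes> g)) = g" if "g \<in> carrier G" for g
      using x that by (simp_all flip: m_assoc) (simp add: inv_mult_group m_assoc)
    have "Poly_Mapping.lookup (group_ring_mult G \<alpha> b) ((x \<otimes> x) \<otimes> g) =
        Poly_Mapping.lookup b (x \<otimes> (x \<otimes> g)) + Poly_Mapping.lookup b (x \<otimes> g)
          + Poly_Mapping.lookup b g" if "g \<in> carrier G" for g
      using x b that
      by (simp add: \<alpha>' group_ring_mult_add_left lookup_add lookup_group_elem_mult
          numeral_2_eq_2 m_assoc)
    then have "Poly_Mapping.lookup (group_ring_mult G \<alpha> b) ((x \<otimes> x) \<otimes> g) = ?T g"
      if "g \<in> carrier G" for g
      using that by (simp only: add_ac)
    with x show ?thesis by (intro that[of "x \<otimes> x"]) simp_all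
  qed
  have "Poly_Mapping.keys \<alpha> \<subseteq> carrier G"
    using \<alpha> x unfolding group_elem_def
    by (auto dest!: subsetD[OF Poly_Mapping.keys_add] split: if_splits)
  then have supp: "Poly_Mapping.keys (group_ring_mult G \<alpha> b) \<subseteq> carrier G"
    using b by (rule keys_group_ring_mult[OF is_monoid])
  show ?thesis
  proof
    assume "group_ring_mult G \<alpha> b = 0"
    then show "\<forall>g\<in>carrier G. ?T g = 0"
      using coeff by (metis lookup_zero)
  next
    assume T: "\<forall>g\<in>carrier G. ?T g = 0"
    show "group_ring_mult G \<alpha> b = 0"
    proof (rule poly_mapping_eqI)
      fix h
      show "Poly_Mapping.lookup (group_ring_mult G \<alpha> b) h = Poly_Mapping.lookup 0 h"
      proof (cases "h \<in> carrier G")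
        case True
        then show ?thesis
          using T coeff[of "inv y \<otimes> h"] y by (simp flip: m_assoc)
      next
        case False
        then show ?thesis
          using supp by (metis in_keys_iff lookup_zero subsetD)
      qed
    qed
  qed
qed

section \<open>Powers of an element\<close>

text \<open>
  Since \<open>ord x = 0\<close> encodes infinite order, the exponent set covers both cases: all exponents
  if the order is infinite, those below the order otherwise.
\<close>
lemma nat_pow_inj_on_below_ord:
  assumes x: "x \<in> carrier G"
  shows "inj_on (\<lambda>k::nat. x [^] k) {k. ord x = 0 \<or> k < ord x}"
proof (rule linorder_inj_onI)
  fix i j :: nat
  assume ij: "i < j" and j: "j \<in> {k. ord x = 0 \<or> k < ord x}"
  show "x [^] i \<noteq> x [^] j"
  proof
    assume "x [^] i = x [^] j"
    then have "x [^] i \<otimes> x [^] (j - i) = x [^] i"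
      using nat_pow_mult[of x i "j - i"] x ij by simp
    then have "ord x dvd j - i"
      using x by (simp flip: pow_eq_id)
    with ij j show False
      by (auto dest: dvd_imp_le)
  qed
qed auto

lemma nat_pow_mod_ord:
  assumes x: "x \<in> carrier G"
  shows "x [^] (k mod ord x) = x [^] (k::nat)"
proof -
  have "x [^] k = x [^] (ord x * (k div ord x) + k mod ord x)"
    by simp
  also have "\<dots> = (x [^] ord x) [^] (k div ord x) \<otimes> x [^] (k mod ord x)"
    using x by (simp only: nat_pow_mult nat_pow_pow)
  finally show ?thesis
    using x by simp
qed

text \<open>
  For \<open>x\<close> of finite order the powers with natural exponents already form the subgroup
  \<open>\<langle>x\<rangle>\<close>. Multiplication by \<open>x\<close> therefore never leaves or enters it, which is what makes
  restriction to \<open>\<langle>x\<rangle>\<close> compatible with the three-term condition.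
\<close>
lemma mult_mem_powers_iff:
  assumes x: "x \<in> carrier G" and "ord x \<noteq> 0" and g: "g \<in> carrier G"
  shows "x \<otimes> g \<in> range (\<lambda>k::nat. x [^] k) \<longleftrightarrow> g \<in> range (\<lambda>k::nat. x [^] k)"
proof
  assume "g \<in> range (\<lambda>k::nat. x [^] k)"
  then obtain k :: nat where "g = x [^] k"
    by auto
  then have "x \<otimes> g = x [^] Suc k"
    using nat_pow_Suc2[OF x] by simp
  then show "x \<otimes> g \<in> range (\<lambda>k::nat. x [^] k)"
    by blast
next
  assume "x \<otimes> g \<in> range (\<lambda>k::nat. x [^] k)"
  then obtain k :: nat where k: "x \<otimes> g = x [^] k"
    by auto
  \<comment> \<open>Finite order makes \<open>x [^] (ord x - 1)\<close> an inverse of \<open>x\<close>.\<close>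
  have inv: "x [^] (ord x - 1) \<otimes> x = \<one>"
    using x \<open>ord x \<noteq> 0\<close> by (simp flip: nat_pow_Suc)
  have "g = x [^] (ord x - 1) \<otimes> (x \<otimes> g)"
    using x g inv by (simp flip: m_assoc)
  also have "\<dots> = x [^] (ord x - 1 + k)"
    using x by (simp add: k nat_pow_mult)
  finally show "g \<in> range (\<lambda>k::nat. x [^] k)"
    by blast
qed

end

section \<open>The support of a minimal annihilated element\<close>

theorem theorem1p5:
  fixes G (structure)
    and x :: 'a
    and n :: enat
    and \<alpha> \<beta> :: "'a \<Rightarrow>\<^sub>0 bit"
  assumes "group G"
    and "x \<in> carrier G"
    and "n = elem_order G x"
    and "n > 2"
    and "\<alpha> \<in> {\<one>\<^bsub>group_ring_F2 G\<^esub> \<oplus>\<^bsub>group_ring_F2 G\<^esub> group_elem x \<oplus>\<^bsub>group_ring_F2 G\<^esub> group_elem (inv x),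
               \<one>\<^bsub>group_ring_F2 G\<^esub> \<oplus>\<^bsub>group_ring_F2 G\<^esub> group_elem x \<oplus>\<^bsub>group_ring_F2 G\<^esub> group_elem (x [^] (2::nat))}"
    and "\<beta> \<in> carrier (group_ring_F2 G)"
    and "\<beta> \<noteq> \<zero>\<^bsub>group_ring_F2 G\<^esub>"
    and "\<alpha> \<otimes>\<^bsub>group_ring_F2 G\<^esub> \<beta> = \<zero>\<^bsub>group_ring_F2 G\<^esub>"
    and "\<one> \<in> Poly_Mapping.keys \<beta>"
    and "\<And>\<gamma>. \<gamma> \<in> carrier (group_ring_F2 G) \<Longrightarrow> \<gamma> \<noteq> \<zero>\<^bsub>group_ring_F2 G\<^esub> \<Longrightarrow>
            \<alpha> \<otimes>\<^bsub>group_ring_F2 G\<^esub> \<gamma> = \<zero>\<^bsub>group_ring_F2 G\<^esub> \<Longrightarrow>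
            card (Poly_Mapping.keys \<beta>) \<le> card (Poly_Mapping.keys \<gamma>)"
  shows "\<exists>m::nat. n = enat m \<and> 3 dvd m \<and> real (card (Poly_Mapping.keys \<beta>)) = 2 * real m / 3"
proof -
  interpret group G by fact
  let ?f = "Poly_Mapping.lookup \<beta>"
  have x: "x \<in> carrier G" by fact
  have \<alpha>: "\<alpha> \<in> {group_elem \<one> + group_elem x + group_elem (inv x),
                 group_elem \<one> + group_elem x + group_elem (x [^] (2::nat))}"
    using assms(5) by simp
  have \<beta>: "Poly_Mapping.keys \<beta> \<subseteq> carrier G"
    using assms(6) by simp
  have T: "?f g + ?f (x \<otimes> g) + ?f (x \<otimes> (x \<otimes> g)) = 0" if "g \<in> carrier G" for g
    using annihilated_iff_three_term[OF x \<alpha> \<beta>] assms(8) that by simp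
  define u where "u = (\<lambda>k::nat. ?f (x [^] k))"
  interpret three_term_recurrence u
  proof
    show "u k + u (Suc k) + u (Suc (Suc k)) = 0" for k
      unfolding u_def nat_pow_Suc2[OF x] by (rule T) (use x in simp)
  qed
  have u0: "u 0 = 1"
    using assms(9) by (simp add: u_def in_keys_iff)

  have "ord x \<noteq> 0"
  proof
    assume "ord x = 0"
    then have "inj (\<lambda>k::nat. x [^] k)"
      using nat_pow_inj_on_below_ord[OF x] by simp
    moreover have "inj (\<lambda>k::nat. 3 * k)"
      by (simp add: inj_def)
    ultimately have "inj ((\<lambda>k::nat. x [^] k) \<circ> (\<lambda>k::nat. 3 * k))"
      by (rule inj_compose)
    then have "infinite (range ((\<lambda>k::nat. x [^] k) \<circ> (\<lambda>k::nat. 3 * k)))"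
      by (rule range_inj_infinite)
    moreover have "range ((\<lambda>k::nat. x [^] k) \<circ> (\<lambda>k::nat. 3 * k)) \<subseteq> Poly_Mapping.keys \<beta>"
      using u0 period_multiple_3[of 0] by (auto simp: u_def in_keys_iff)
    ultimately show False
      using finite_subset finite_keys by blast
  qed
  then have n: "n = enat (ord x)"
    using assms(3) by (simp add: elem_order_def)

  have "u (k + ord x) = u k" for k
    using x by (simp add: u_def flip: nat_pow_mult)
  then have "3 dvd ord x"
    using u0 dvd_period by blast
  then obtain q where q: "ord x = 3 * q" ..

  define P where "P = range (\<lambda>k::nat. x [^] k)"
  define \<gamma> where "\<gamma> = (\<Sum>g\<in>Poly_Mapping.keys \<beta> \<inter> P. Poly_Mapping.single g (?f g))"
  have lookup_\<gamma>: "Poly_Mapping.lookup \<gamma> g = (if g \<in> P then ?f g else 0)" for g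
    by (auto simp: \<gamma>_def lookup_sum lookup_single when_def in_keys_iff)
  have keys_\<gamma>: "Poly_Mapping.keys \<gamma> = Poly_Mapping.keys \<beta> \<inter> P"
    by (auto simp: in_keys_iff lookup_\<gamma> split: if_splits)
  have \<gamma>: "Poly_Mapping.keys \<gamma> \<subseteq> carrier G"
    using keys_\<gamma> \<beta> by blast
  have "group_ring_mult G \<alpha> \<gamma> = 0"
    unfolding annihilated_iff_three_term[OF x \<alpha> \<gamma>]
  proof
    fix g assume g: "g \<in> carrier G"
    have "x \<otimes> g \<in> P \<longleftrightarrow> g \<in> P" "x \<otimes> (x \<otimes> g) \<in> P \<longleftrightarrow> g \<in> P"
      using mult_mem_powers_iff[OF x \<open>ord x \<noteq> 0\<close>] g x by (simp_all add: P_def)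
    then show "Poly_Mapping.lookup \<gamma> g + Poly_Mapping.lookup \<gamma> (x \<otimes> g)
        + Poly_Mapping.lookup \<gamma> (x \<otimes> (x \<otimes> g)) = 0"
      using T[OF g] by (simp add: lookup_\<gamma>)
  qed
  moreover have "\<one> \<in> P"
    unfolding P_def by (rule range_eqI[of _ _ 0]) simp
  then have "\<gamma> \<noteq> 0"
    using assms(9) keys_\<gamma> by auto
  ultimately have "card (Poly_Mapping.keys \<beta>) \<le> card (Poly_Mapping.keys \<gamma>)"
    using assms(10)[of \<gamma>] \<gamma> by simp
  then have "Poly_Mapping.keys \<beta> \<subseteq> P"
    using keys_\<gamma> by (metis Int_lower1 Int_lower2 card_seteq finite_keys)
  \<comment> \<open>The exponents below \<open>ord x\<close> enumerate \<open>P\<close> without repetition, so the ones of \<open>u\<close> there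
    count the support.\<close>
  have "Poly_Mapping.keys \<beta> = (\<lambda>k. x [^] k) ` {k. k < 3 * q \<and> u k = 1}"
  proof
    show "Poly_Mapping.keys \<beta> \<subseteq> (\<lambda>k. x [^] k) ` {k. k < 3 * q \<and> u k = 1}"
    proof
      fix g assume g: "g \<in> Poly_Mapping.keys \<beta>"
      then obtain k :: nat where "g = x [^] k"
        using \<open>Poly_Mapping.keys \<beta> \<subseteq> P\<close> by (auto simp: P_def)
      moreover have "x [^] k = x [^] (k mod ord x)"
        using x by (simp add: nat_pow_mod_ord)
      moreover have "k mod ord x < 3 * q"
        using \<open>ord x \<noteq> 0\<close> q by simp
      ultimately show "g \<in> (\<lambda>k. x [^] k) ` {k. k < 3 * q \<and> u k = 1}"
        using g by (auto simp: u_def in_keys_iff)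
    qed
  qed (auto simp: u_def in_keys_iff)
  moreover have "inj_on (\<lambda>k::nat. x [^] k) {k. k < 3 * q \<and> u k = 1}"
    using nat_pow_inj_on_below_ord[OF x] by (rule inj_on_subset) (auto simp: q)
  ultimately have "card (Poly_Mapping.keys \<beta>) = 2 * q"
    using card_ones[OF u0] by (simp add: card_image)
  then show ?thesis
    using n q by auto
qed

end
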